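(* Let $\mathbb F$ be a semifield and let $m,n$ be positive integers. Let $\mathcal L=\{(x,y,t)\in\mathbb Z^3 : 0\le x\le m,\ 0\le y\le n,\ x+y+t\equiv 0 \pmod 2\}$, and let $f:\mathcal L\to\mathbb F$ be a function satisfying the bounded octahedron recurrence. Then there exists a constant $c\in\mathbb F$ such that for every $(x,y,t)\in\mathcal L$, $$f(x,y,t)=c\cdot f(m-x,\,n-y,\,t-m-n).$$
   Context: A semifield is a set $\mathbb F$ with an addition that is commutative and associative and a multiplication making $\mathbb F$ an abelian group, with multiplication distributing over addition (e.g. $\mathbb R_{>0}$ with the usual operations, or $\mathbb R$ with $\max$ as addition and $+$ as multiplication). A function $f:\mathcal L\to\mathbb F$ satisfies the bounded octahedron recurrence if for every $(x,y,t)\in\mathbb Z^3$ with $0\le x\le m$, $0\le y\le n$ and $x+y+t$ odd (so that $(x,y,t\pm1)\in\mathcal L$), the following holds: (i) if $0<x<m$, $0<y<n$: $f(x,y,t+1)=\big(f(x+1,y,t)f(x-1,y,t)+f(x,y+1,t)f(x,y-1,t)\big)/f(x,y,t-1)$; (ii) if $0<x<m$ and $y\in\{0,n\}$: $f(x,y,t+1)=f(x+1,y,t)f(x-1,y,t)/f(x,y,t-1)$; (iii) if $0<y<n$ and $x\in\{0,m\}$: $f(x,y,t+1)=f(x,y+1,t)f(x,y-1,t)/f(x,y,t-1)$; (iv) $f(0,0,t+1)=f(1,0,t)f(0,1,t)/f(0,0,t-1)$; $f(0,n,t+1)=f(1,n,t)f(0,n-1,t)/f(0,n,t-1)$; $f(m,0,t+1)=f(m-1,0,t)f(m,1,t)/f(m,0,t-1)$;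 $f(m,n,t+1)=f(m-1,n,t)f(m,n-1,t)/f(m,n,t-1)$. *)

theory Defs
  imports Complex_Main
begin

text \<open>
  A semifield has no zero: the whole type is an abelian group under multiplication,
  and inverse and division are total without any side condition.
\<close>

class semifield = comm_semiring + comm_monoid_mult + inverse +
  assumes semifield_left_inverse: "inverse a * a = 1"
    and semifield_divide_inverse: "a / b = a * inverse b"

text \<open>The tropical semifield: addition is maximum, multiplication is the sum of reals.\<close>

lemma semifield_max_plus: "class.semifield (-) uminus (+) (0 :: real) max"
  by unfold_locales auto

definition octahedron_lattice :: "int \<Rightarrow> int \<Rightarrow> (int \<times> int \<times> int) set" where
  "octahedron_lattice m n =
     {(x, y, t). 0 \<le> x \<and> x \<le> m \<and> 0 \<le> y \<and> y \<le> n \<and> even (x + y + t)}"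

text \<open>
  A function on the lattice is represented by a function on all integer triples; the
  recurrence below only mentions values at lattice points, because \<open>x + y + t\<close> is odd.
\<close>

definition bounded_octahedron_recurrence ::
    "int \<Rightarrow> int \<Rightarrow> (int \<times> int \<times> int \<Rightarrow> 'a::semifield) \<Rightarrow> bool" where
  "bounded_octahedron_recurrence m n f \<longleftrightarrow>
    (\<forall>x y t. 0 \<le> x \<and> x \<le> m \<and> 0 \<le> y \<and> y \<le> n \<and> odd (x + y + t) \<longrightarrow>
      (0 < x \<and> x < m \<and> 0 < y \<and> y < n \<longrightarrow>
         f (x, y, t + 1) =
           (f (x + 1, y, t) * f (x - 1, y, t) + f (x, y + 1, t) * f (x, y - 1, t))
             / f (x, y, t - 1)) \<and>
      (0 < x \<and> x < m \<and> (y = 0 \<or> y = n) \<longrightarrow>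
         f (x, y, t + 1) = f (x + 1, y, t) * f (x - 1, y, t) / f (x, y, t - 1)) \<and>
      (0 < y \<and> y < n \<and> (x = 0 \<or> x = m) \<longrightarrow>
         f (x, y, t + 1) = f (x, y + 1, t) * f (x, y - 1, t) / f (x, y, t - 1)) \<and>
      (x = 0 \<and> y = 0 \<longrightarrow>
         f (0, 0, t + 1) = f (1, 0, t) * f (0, 1, t) / f (0, 0, t - 1)) \<and>
      (x = 0 \<and> y = n \<longrightarrow>
         f (0, n, t + 1) = f (1, n, t) * f (0, n - 1, t) / f (0, n, t - 1)) \<and>
      (x = m \<and> y = 0 \<longrightarrow>
         f (m, 0, t + 1) = f (m - 1, 0, t) * f (m, 1, t) / f (m, 0, t - 1)) \<and>
      (x = m \<and> y = n \<longrightarrow>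
         f (m, n, t + 1) = f (m - 1, n, t) * f (m, n - 1, t) / f (m, n, t - 1)))"

end

theory Submission
  imports Defs
    "HOL-Library.Poly_Mapping"
    "HOL-Library.Multiset_Order"
    "HOL-Library.Nat_Bijection"
    "HOL-Computational_Algebra.Polynomial_Factorial"
    "Jordan_Normal_Form.Determinant"
begin

text \<open>
  Over a field, the recurrence is a three-term Pluecker relation. Put \<open>N = m + n\<close> and take vectors
  \<open>v\<^sub>i\<close> in an \<open>m\<close>-dimensional space with \<open>v\<^bsub>i+N\<^esub> = (-1)\<^bsup>m-1\<^esup> v\<^sub>i\<close>. The value at \<open>(x, y, x + y + 2a)\<close>
  is, up to a plane wave, the determinant of the block of \<open>x\<close> vectors starting at \<open>v\<^sub>a\<close> followed by the
  block of \<open>m - x\<close> vectors which starts after a gap of length \<open>y\<close>. The symmetry of the theorem exchanges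
  the two blocks. Such determinants realise arbitrary nonzero values on the slice \<open>a = 0\<close>, and these values
  determine the solution.

  For an arbitrary semifield take indeterminates as the values on the slice. The solution over the field
  of rational functions then consists of quotients of nonzero polynomials with natural coefficients, which
  can be evaluated in the semifield, and the identity survives the evaluation.
\<close>

subsection \<open>Evaluating rational functions in a semifield\<close>

text \<open>A semifield need not have an additive neutral element, so an empty sum may have no
  value. Adjoining \<open>Zero\<close> gives a \<open>comm_semiring_1\<close>, so that one
  evaluation serves semifields and rational functions alike.\<close>

datatype 'a with_zero = Zero | Elem 'a

instantiation with_zero :: ("{comm_semiring, comm_monoid_mult}") comm_semiring_1
begin

definition "0 = Zero"
definition "1 = Elem 1"
fun plus_with_zero where
  "Zero + y = y"
| "Elem a + Zero = Elem a"
| "Elem a + Elem b = Elem (a + b)"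
fun times_with_zero where
  "Elem a * Elem b = Elem (a * b)"
| "Zero * _ = Zero"
| "Elem _ * Zero = Zero"

instance
proof
  fix a b c :: "'a with_zero"
  show "a + b + c = a + (b + c)"
    by (cases a; cases b; cases c) (auto simp: ac_simps)
  show "a + b = b + a"
    by (cases a; cases b) (auto simp: ac_simps)
  show "0 + a = a" "0 * a = 0" "a * 0 = 0"
    by (cases a; simp add: zero_with_zero_def)+
  show "a * b * c = a * (b * c)"
    by (cases a; cases b; cases c) (auto simp: ac_simps)
  show "a * b = b * a"
    by (cases a; cases b) (auto simp: ac_simps)
  show "1 * a = a"
    by (cases a) (auto simp: one_with_zero_def)
  show "(a + b) * c = a * c + b * c"
    by (cases a; cases b; cases c) (auto simp: algebra_simps)
  show "(0 :: 'a with_zero) \<noteq> 1"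
    by (simp add: one_with_zero_def zero_with_zero_def)
qed

end

section \<open>Polynomials with natural coefficients\<close>

definition eval_mon :: "('v \<Rightarrow> 'b::comm_monoid_mult) \<Rightarrow> 'v multiset \<Rightarrow> 'b" where
  "eval_mon s a = prod_mset (image_mset s a)"

text \<open>A monomial is a multiset of variables and a polynomial a multiset of monomials:
  multiplicities are the exponents and the coefficients.\<close>

definition eval_poly :: "('v \<Rightarrow> 'b::comm_semiring_1) \<Rightarrow> 'v multiset multiset \<Rightarrow> 'b" where
  "eval_poly s P = (\<Sum>a\<in>#P. eval_mon s a)"

definition times_poly :: "'v multiset multiset \<Rightarrow> 'v multiset multiset \<Rightarrow> 'v multiset multiset" where
  "times_poly P Q = (\<Sum>a\<in>#P. image_mset ((+) a) Q)"

lemma eval_poly_simps [simp]: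
  "eval_poly s {#} = 0" "eval_poly s (add_mset a P) = eval_mon s a + eval_poly s P"
  "eval_poly s (P + Q) = eval_poly s P + eval_poly s Q"
  by (simp_all add: eval_poly_def)

lemma eval_mon_add: "eval_mon s (a + b) = eval_mon s a * eval_mon s b"
  by (simp add: eval_mon_def)

lemma eval_poly_times [simp]: "eval_poly s (times_poly P Q) = eval_poly s P * eval_poly s Q"
proof -
  have inner: "eval_poly s (image_mset ((+) a) Q) = eval_mon s a * eval_poly s Q" for a
    by (induction Q) (simp_all add: eval_mon_add distrib_left)
  show ?thesis
    by (induction P) (simp_all add: times_poly_def inner distrib_right)
qed

lemma times_poly_nonempty:
  "P \<noteq> {#} \<Longrightarrow> Q \<noteq> {#} \<Longrightarrow> times_poly P Q \<noteq> {#}"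
  by (cases P; cases Q) (auto simp: times_poly_def)

text \<open>The linear order on multisets is compatible with addition, which makes this polynomial
  ring an integral domain, as \<open>fract\<close> requires.\<close>

type_synonym rat_fun = "(nat multiset \<Rightarrow>\<^sub>0 int) fract"

definition indet :: "nat \<Rightarrow> rat_fun" where
  "indet i = to_fract (Poly_Mapping.single {#i#} 1)"

lemma eval_mon_indet: "eval_mon indet a = to_fract (Poly_Mapping.single a 1)"
proof (induction a)
  case empty
  show ?case by (simp add: eval_mon_def)
next
  case (add i a)
  have "eval_mon indet (add_mset i a) = indet i * eval_mon indet a"
    by (simp add: eval_mon_def)
  also have "\<dots> = to_fract (Poly_Mapping.single {#i#} 1 * Poly_Mapping.single a 1)"
    by (simp only: add.IH indet_def to_fract_mult)
  finally show ?case by (simp add: mult_single)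
qed

lemma eval_poly_indet:
  "eval_poly indet P = to_fract (\<Sum>a\<in>#P. Poly_Mapping.single a 1)"
  by (induction P) (simp_all add: eval_mon_indet)

lemma lookup_sum_single:
  "Poly_Mapping.lookup (\<Sum>a\<in>#P. Poly_Mapping.single a (1::int)) b = int (count P b)"
  by (induction P) (auto simp: lookup_add lookup_single)

text \<open>Distinct monomials are linearly independent, so the coefficients recover the counts. An
  identity of rational functions thus becomes an equality of multisets, which can be evaluated
  anywhere.\<close>

lemma eval_poly_indet_inject: "eval_poly indet P = eval_poly indet Q \<longleftrightarrow> P = Q"
proof
  assume "eval_poly indet P = eval_poly indet Q"
  then have "(\<Sum>a\<in>#P. Poly_Mapping.single a (1::int)) = (\<Sum>a\<in>#Q. Poly_Mapping.single a 1)"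
    by (simp add: eval_poly_indet)
  then have "int (count P b) = int (count Q b)" for b
    by (metis lookup_sum_single)
  then show "P = Q" by (simp add: multiset_eq_iff)
qed simp

lemma eval_poly_indet_eq_0: "eval_poly indet P = 0 \<longleftrightarrow> P = {#}"
  using eval_poly_indet_inject [of P "{#}"] by simp

lemma eval_mon_Elem: "\<exists>u. eval_mon (Elem \<circ> s) a = Elem u"
  by (induction a) (auto simp: eval_mon_def one_with_zero_def)

text \<open>A nonempty sum of monomials never takes the value \<open>Zero\<close>, so nonempty
  denominators can be cancelled.\<close>

lemma eval_poly_Elem: "P \<noteq> {#} \<Longrightarrow> \<exists>u. eval_poly (Elem \<circ> s) P = Elem u"
proof (induction P)
  case (add a P)
  obtain u where u: "eval_mon (Elem \<circ> s) a = Elem u" using eval_mon_Elem by blast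
  show ?case
  proof (cases "P = {#}")
    case True
    then have "eval_poly (Elem \<circ> s) (add_mset a P) = Elem u" using u by simp
    then show ?thesis ..
  next
    case False
    with add.IH obtain w where "eval_poly (Elem \<circ> s) P = Elem w" by blast
    then have "eval_poly (Elem \<circ> s) (add_mset a P) = Elem (u + w)" using u by simp
    then show ?thesis ..
  qed
qed simp

section \<open>Specialization of rational functions\<close>

lemma semifield_right_inverse: "a * inverse a = (1 :: 'a::semifield)"
  by (metis mult.commute semifield_left_inverse)

lemma semifield_mult_right_cancel: "a * c = b * c \<longleftrightarrow> a = (b :: 'a::semifield)"
  by (metis mult.assoc mult.right_neutral semifield_right_inverse)

lemma semifield_eq_divide: "a = b / c \<longleftrightarrow> a * c = (b :: 'a::semifield)"
  by (metis mult.assoc mult.right_neutral semifield_divide_inverse semifield_left_inverse semifield_right_inverse)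

text \<open>A relation rather than a function, because fractions representing \<open>k\<close> are
  not unique. The equations are cross-multiplied since \<open>with_zero\<close> has no
  division.\<close>

definition specializes :: "(nat \<Rightarrow> 'a::semifield) \<Rightarrow> rat_fun \<Rightarrow> 'a \<Rightarrow> bool" where
  "specializes s k u \<longleftrightarrow> (\<exists>P Q. P \<noteq> {#} \<and> Q \<noteq> {#} \<and>
     k * eval_poly indet Q = eval_poly indet P \<and>
     Elem u * eval_poly (Elem \<circ> s) Q = eval_poly (Elem \<circ> s) P)"

lemma specializes_nonzero: "specializes s k u \<Longrightarrow> k \<noteq> 0"
  by (auto simp: specializes_def eval_poly_indet_eq_0)

text \<open>After cross-multiplication, two fractions for \<open>k\<close> agree as multisets of
  monomials. They therefore agree under evaluation, and the denominators cancel in the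
  semifield.\<close>

lemma specializes_unique:
  assumes "specializes s k u" "specializes s k w"
  shows "u = w"
proof -
  obtain P Q where PQ: "P \<noteq> {#}" "Q \<noteq> {#}" "k * eval_poly indet Q = eval_poly indet P"
      "Elem u * eval_poly (Elem \<circ> s) Q = eval_poly (Elem \<circ> s) P"
    using assms(1) unfolding specializes_def by blast
  obtain P' Q' where PQ': "P' \<noteq> {#}" "Q' \<noteq> {#}" "k * eval_poly indet Q' = eval_poly indet P'"
      "Elem w * eval_poly (Elem \<circ> s) Q' = eval_poly (Elem \<circ> s) P'"
    using assms(2) unfolding specializes_def by blast
  have "eval_poly indet (times_poly P Q') = eval_poly indet (times_poly P' Q)"
    by (simp add: PQ(3) [symmetric] PQ'(3) [symmetric] mult_ac)
  then have "times_poly P Q' = times_poly P' Q"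
    by (simp only: eval_poly_indet_inject)
  then have "eval_poly (Elem \<circ> s) (times_poly P Q') = eval_poly (Elem \<circ> s) (times_poly P' Q)"
    by simp
  then have eq: "Elem u * eval_poly (Elem \<circ> s) Q * eval_poly (Elem \<circ> s) Q' =
      Elem w * eval_poly (Elem \<circ> s) Q' * eval_poly (Elem \<circ> s) Q"
    by (simp add: PQ(4) PQ'(4))
  obtain a b where "eval_poly (Elem \<circ> s) Q = Elem a" "eval_poly (Elem \<circ> s) Q' = Elem b"
    using eval_poly_Elem PQ(2) PQ'(2) by metis
  with eq have "u * (a * b) = w * (a * b)" by (simp add: mult_ac)
  then show ?thesis by (simp add: semifield_mult_right_cancel)
qed

lemma specializes_indet: "specializes s (indet i) (s i)"
  unfolding specializes_def
  by (rule exI [of _ "{#{#i#}#}"], rule exI [of _ "{#{#}#}"]) (simp add: eval_mon_def)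

lemma specializes_mult:
  assumes "specializes s k u" "specializes s l w"
  shows "specializes s (k * l) (u * w)"
proof -
  obtain P Q where PQ: "P \<noteq> {#}" "Q \<noteq> {#}" "k * eval_poly indet Q = eval_poly indet P"
      "Elem u * eval_poly (Elem \<circ> s) Q = eval_poly (Elem \<circ> s) P"
    using assms(1) unfolding specializes_def by blast
  obtain P' Q' where PQ': "P' \<noteq> {#}" "Q' \<noteq> {#}" "l * eval_poly indet Q' = eval_poly indet P'"
      "Elem w * eval_poly (Elem \<circ> s) Q' = eval_poly (Elem \<circ> s) P'"
    using assms(2) unfolding specializes_def by blast
  have "Elem (u * w) = Elem u * Elem w" by simp
  then show ?thesis unfolding specializes_def
    by (intro exI [of _ "times_poly P P'"] exI [of _ "times_poly Q Q'"])
      (simp only: times_poly_nonempty PQ(1,2) PQ'(1,2) eval_poly_times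
        PQ(3,4) [symmetric] PQ'(3,4) [symmetric] mult_ac simp_thms not_False_eq_True)
qed

lemma specializes_add:
  assumes "specializes s k u" "specializes s l w"
  shows "specializes s (k + l) (u + w)"
proof -
  obtain P Q where PQ: "P \<noteq> {#}" "Q \<noteq> {#}" "k * eval_poly indet Q = eval_poly indet P"
      "Elem u * eval_poly (Elem \<circ> s) Q = eval_poly (Elem \<circ> s) P"
    using assms(1) unfolding specializes_def by blast
  obtain P' Q' where PQ': "P' \<noteq> {#}" "Q' \<noteq> {#}" "l * eval_poly indet Q' = eval_poly indet P'"
      "Elem w * eval_poly (Elem \<circ> s) Q' = eval_poly (Elem \<circ> s) P'"
    using assms(2) unfolding specializes_def by blast
  have "Elem (u + w) = Elem u + Elem w" by simp
  moreover have "times_poly P Q' + times_poly P' Q \<noteq> {#}"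
    using times_poly_nonempty PQ(1) PQ'(2) by auto
  ultimately show ?thesis unfolding specializes_def
    by (intro exI [of _ "times_poly P Q' + times_poly P' Q"] exI [of _ "times_poly Q Q'"])
      (simp only: times_poly_nonempty PQ(1,2) PQ'(1,2) eval_poly_times eval_poly_simps
        PQ(3,4) [symmetric] PQ'(3,4) [symmetric] algebra_simps simp_thms not_False_eq_True)
qed

lemma specializes_divide:
  assumes "specializes s k u" "specializes s l w"
  shows "specializes s (k / l) (u / w)"
proof -
  obtain P Q where PQ: "P \<noteq> {#}" "Q \<noteq> {#}" "l * eval_poly indet Q = eval_poly indet P"
      "Elem w * eval_poly (Elem \<circ> s) Q = eval_poly (Elem \<circ> s) P"
    using assms(2) unfolding specializes_def by blast
  have l: "l \<noteq> 0" using assms(2) by (rule specializes_nonzero)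
  have "Elem (inverse w) * Elem w = 1"
    by (simp add: semifield_left_inverse one_with_zero_def)
  then have "Elem (inverse w) * (Elem w * z) = z" for z
    by (simp flip: mult.assoc)
  then have "specializes s (inverse l) (inverse w)"
    unfolding specializes_def using PQ(1,2) l
    by (intro exI [of _ Q] exI [of _ P])
      (simp flip: PQ(3,4) add: mult.assoc [symmetric])
  with assms(1) show ?thesis
    by (simp add: specializes_mult divide_inverse semifield_divide_inverse)
qed

subsection \<open>Determinants of lists of vectors\<close>

text \<open>Vectors are functions on all of \<open>nat\<close>; the number of rows also fixes how
  many coordinates count.\<close>

definition rows_det :: "(nat \<Rightarrow> 'a::comm_ring_1) list \<Rightarrow> 'a" where
  "rows_det vs = det (mat (length vs) (length vs) (\<lambda>(i, j). (vs ! i) j))"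

text \<open>Laplace expansion along the distinguished row, whose cofactors do not involve that row.
  Multilinearity follows from it.\<close>

lemma rows_det_linear_form:
  "\<exists>c. \<forall>x. rows_det (as @ x # bs) = (\<Sum>j < Suc (length as + length bs). x j * c j)"
proof -
  let ?i = "length as" and ?n = "Suc (length as + length bs)"
  let ?A = "\<lambda>x. mat ?n ?n (\<lambda>(i, j). ((as @ x # bs) ! i) j)"
  have del: "mat_delete (?A x) ?i j = mat_delete (?A y) ?i j" for x y j
    unfolding mat_delete_def by (rule eq_matI) (auto simp: nth_append)
  have "rows_det (as @ x # bs) = (\<Sum>j < ?n. x j * cofactor (?A (\<lambda>_. 0)) ?i j)" for x
  proof -
    have "rows_det (as @ x # bs) = det (?A x)"
      by (simp add: rows_det_def)
    also have "\<dots> = (\<Sum>j < ?n. ?A x $$ (?i, j) * cofactor (?A x) ?i j)"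
      by (rule laplace_expansion_row) auto
    also have "\<dots> = (\<Sum>j < ?n. x j * cofactor (?A (\<lambda>_. 0)) ?i j)"
      unfolding cofactor_def del [of x _ "\<lambda>_. 0"] by (intro sum.cong) auto
    finally show ?thesis .
  qed
  then show ?thesis by blast
qed

lemma rows_det_add:
  "rows_det (as @ (\<lambda>j. x j + y j) # bs) = rows_det (as @ x # bs) + rows_det (as @ y # bs)"
proof -
  obtain c where "\<And>x. rows_det (as @ x # bs) = (\<Sum>j < Suc (length as + length bs). x j * c j)"
    using rows_det_linear_form by blast
  then show ?thesis by (simp only: distrib_right sum.distrib)
qed

lemma rows_det_sum:
  "rows_det (as @ (\<lambda>j. \<Sum>i\<in>I. c i * w i j) # bs) = (\<Sum>i\<in>I. c i * rows_det (as @ w i # bs))"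
proof -
  obtain d where "\<And>x. rows_det (as @ x # bs) = (\<Sum>j < Suc (length as + length bs). x j * d j)"
    using rows_det_linear_form by blast
  then show ?thesis
    by (simp only: sum_distrib_left sum_distrib_right mult.assoc) (rule sum.swap)
qed

lemma rows_det_scale:
  "rows_det (as @ (\<lambda>j. c * x j) # bs) = c * rows_det (as @ x # bs)"
  using rows_det_sum [of as "\<lambda>_. c" "\<lambda>_. x" "{0::nat}" bs] by simp

lemma rows_det_cong:
  assumes "\<And>j. j < Suc (length as + length bs) \<Longrightarrow> x j = y j"
  shows "rows_det (as @ x # bs) = rows_det (as @ y # bs)"
proof -
  obtain c where "\<And>x. rows_det (as @ x # bs) = (\<Sum>j < Suc (length as + length bs). x j * c j)"
    using rows_det_linear_form by blast
  with assms show ?thesis by simp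
qed

lemma rows_det_repeated: "rows_det (as @ x # bs @ x # cs) = 0"
  unfolding rows_det_def
  by (rule det_identical_rows [of _ _ "length as" "Suc (length as + length bs)"])
    (auto simp: nth_append)

lemma rows_det_swap: "rows_det (as @ x # y # bs) = - rows_det (as @ y # x # bs)"
proof -
  have add2: "rows_det (as @ v # (\<lambda>j. x j + y j) # bs)
      = rows_det (as @ v # x # bs) + rows_det (as @ v # y # bs)" for v
    using rows_det_add [of "as @ [v]" x y bs] by simp
  have dup: "rows_det (as @ v # v # bs) = 0" for v
    using rows_det_repeated [of as v "[]" bs] by simp
  \<comment> \<open>Polarization: a determinant with two equal rows \<open>x + y\<close> is expanded
    in both.\<close>
  have "0 = rows_det (as @ (\<lambda>j. x j + y j) # (\<lambda>j. x j + y j) # bs)"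
    by (simp add: dup)
  also have "\<dots> = rows_det (as @ x # y # bs) + rows_det (as @ y # x # bs)"
    by (simp only: rows_det_add add2 dup) simp
  finally show ?thesis by (simp add: eq_neg_iff_add_eq_0)
qed

lemma rows_det_move:
  "rows_det (as @ x # bs @ cs) = (- 1) ^ length bs * rows_det (as @ bs @ x # cs)"
proof (induction bs arbitrary: as)
  case (Cons b bs)
  have "rows_det (as @ x # (b # bs) @ cs) = - rows_det ((as @ [b]) @ x # bs @ cs)"
    by (simp add: rows_det_swap [of as x b])
  also have "\<dots> = (- 1) ^ length (b # bs) * rows_det (as @ (b # bs) @ x # cs)"
    by (simp add: Cons.IH del: append_assoc) simp
  finally show ?case .
qed simp

lemma rows_det_rotate:
  "rows_det (xs @ ys) = (- 1) ^ (length xs * length ys) * rows_det (ys @ xs)"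
proof (induction xs arbitrary: ys)
  case (Cons x xs)
  have "rows_det ((x # xs) @ ys) = (- 1) ^ (length xs + length ys) * rows_det (xs @ (ys @ [x]))"
    using rows_det_move [of "[]" x "xs @ ys" "[]"] by simp
  also have "\<dots> = (- 1) ^ (length xs + length ys) * (- 1) ^ (length xs * Suc (length ys))
      * rows_det (ys @ x # xs)"
    by (simp add: Cons.IH mult.assoc)
  also have "(- 1) ^ (length xs + length ys) * (- 1) ^ (length xs * Suc (length ys))
      = ((- 1) ^ (2 * length xs) * (- 1) ^ (length (x # xs) * length ys) :: 'a)"
    by (auto simp: minus_one_power_iff)
  finally show ?case by simp
qed simp

lemma rows_det_append_map_scale:
  "rows_det (as @ map (\<lambda>v j. c * v j) vs) = c ^ length vs * rows_det (as @ vs)"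
proof (induction vs arbitrary: as)
  case (Cons v vs)
  have "rows_det (as @ map (\<lambda>v j. c * v j) (v # vs))
      = c * rows_det ((as @ [v]) @ map (\<lambda>v j. c * v j) vs)"
    by (simp add: rows_det_scale)
  also have "\<dots> = c ^ length (v # vs) * rows_det (as @ v # vs)"
    by (simp add: Cons.IH del: append_assoc) simp
  finally show ?case .
qed simp

section \<open>Cramer's rule and the Pluecker relation\<close>

lemma rows_det_spanning:
  fixes ws :: "(nat \<Rightarrow> 'a::field) list"
  assumes "rows_det ws \<noteq> 0"
  obtains c where "\<And>j. j < length ws \<Longrightarrow> z j = (\<Sum>i < length ws. c i * (ws ! i) j)"
proof -
  let ?n = "length ws"
  define A where "A = mat ?n ?n (\<lambda>(i, j). (ws ! i) j)"
  have A: "A \<in> carrier_mat ?n ?n" by (simp add: A_def)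
  have d: "det A \<noteq> 0" using assms by (simp add: rows_det_def A_def)
  \<comment> \<open>Cramer's rule: \<open>c\<close> is the row vector \<open>z\<close> times the
    inverse \<open>adj_mat A / det A\<close>.\<close>
  define c where "c i = (\<Sum>k < ?n. z k / det A * adj_mat A $$ (k, i))" for i
  have "z j = (\<Sum>i < ?n. c i * (ws ! i) j)" if j: "j < ?n" for j
  proof -
    have entry: "(\<Sum>i < ?n. adj_mat A $$ (k, i) * (ws ! i) j) = (if k = j then det A else 0)"
      if "k < ?n" for k
    proof -
      have "(adj_mat A * A) $$ (k, j) = (\<Sum>i < ?n. adj_mat A $$ (k, i) * (ws ! i) j)"
        using that j adj_mat(1) [OF A]
        by (simp add: scalar_prod_def A_def lessThan_atLeast0)
      then show ?thesis using that j by (cases "k = j") (simp_all add: adj_mat(3) [OF A])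
    qed
    have "(\<Sum>i < ?n. c i * (ws ! i) j)
        = (\<Sum>k < ?n. z k / det A * (\<Sum>i < ?n. adj_mat A $$ (k, i) * (ws ! i) j))"
      unfolding c_def sum_distrib_left sum_distrib_right mult.assoc by (rule sum.swap)
    also have "\<dots> = (\<Sum>k < ?n. if k = j then z j else 0)"
      by (intro sum.cong) (auto simp: entry d)
    finally show ?thesis using j by simp
  qed
  then show thesis by (rule that)
qed

text \<open>
  Fixing all but two rows leaves an alternating form of rank two, and the
  three-term Pluecker relation is the determinant identity in that plane.
\<close>

lemma rows_det_pluecker_front:
  fixes C :: "(nat \<Rightarrow> 'a::field) list"
  defines "\<omega> \<equiv> \<lambda>x y. rows_det (x # y # C)"
  assumes nz: "\<omega> p r \<noteq> 0"
  shows "\<omega> p r * \<omega> q u = \<omega> p q * \<omega> r u + \<omega> p u * \<omega> q r"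
proof -
  have anti: "\<omega> x y = - \<omega> y x" for x y
    unfolding \<omega>_def using rows_det_swap [of "[]" x y C] by simp
  have self: "\<omega> x x = 0" for x
    unfolding \<omega>_def using rows_det_repeated [of "[]" x "[]" C] by simp
  \<comment> \<open>Since \<open>p\<close>, \<open>r\<close> and \<open>C\<close> span,
    \<open>z\<close> is a combination of them; its components along \<open>C\<close> create a
    repeated row and vanish.\<close>
  have expand: "\<exists>a b. \<forall>s. \<omega> s z = a * \<omega> s p + b * \<omega> s r" for z
  proof -
    let ?ws = "p # r # C"
    obtain c where c: "\<And>j. j < length ?ws \<Longrightarrow> z j = (\<Sum>i < length ?ws. c i * (?ws ! i) j)"
      using rows_det_spanning nz unfolding \<omega>_def by metis
    have "\<omega> s z = c 0 * \<omega> s p + c 1 * \<omega> s r" for s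
    proof -
      have "\<omega> s z = rows_det ([s] @ (\<lambda>j. \<Sum>i < length ?ws. c i * (?ws ! i) j) # C)"
        unfolding \<omega>_def using c rows_det_cong [of "[s]" C z] by simp
      also have "\<dots> = (\<Sum>i < length ?ws. c i * \<omega> s (?ws ! i))"
        by (simp only: rows_det_sum) (simp add: \<omega>_def)
      also have "\<dots> = c 0 * \<omega> s p + (c 1 * \<omega> s r + (\<Sum>i < length C. c (i + 2) * \<omega> s (C ! i)))"
        by (simp add: sum.lessThan_Suc_shift del: sum.lessThan_Suc)
      also have "\<omega> s (C ! i) = 0" if "i < length C" for i
      proof -
        have "C = take i C @ C ! i # drop (Suc i) C" using that by (rule id_take_nth_drop)
        then show ?thesis
          unfolding \<omega>_def
          using rows_det_repeated [of "[s]" "C ! i" "take i C" "drop (Suc i) C"] by simp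
      qed
      then have "(\<Sum>i < length C. c (i + 2) * \<omega> s (C ! i)) = 0" by simp
      finally show ?thesis by simp
    qed
    then show ?thesis by blast
  qed
  obtain a b where q: "\<And>s. \<omega> s q = a * \<omega> s p + b * \<omega> s r" using expand by blast
  obtain a' b' where u: "\<And>s. \<omega> s u = a' * \<omega> s p + b' * \<omega> s r" using expand by blast
  have "\<omega> q p = - b * \<omega> p r" "\<omega> q r = a * \<omega> p r"
    using anti [of q p] anti [of q r] anti [of r p] by (simp_all add: q self)
  then show ?thesis
    using anti [of r p] by (simp add: q u self algebra_simps)
qed

text \<open>Moving \<open>A\<close> and \<open>B\<close> behind the distinguished rows turns each
  factor into a value of \<open>\<omega>\<close> up to sign, and all three products acquire the same
  sign \<open>\<alpha> * \<beta>\<close>.\<close>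

lemma rows_det_pluecker:
  fixes A B :: "(nat \<Rightarrow> 'a::field) list"
  assumes "rows_det (p # A @ r # B) \<noteq> 0 \<or> rows_det (A @ q # B @ [u]) \<noteq> 0"
  shows "rows_det (p # A @ r # B) * rows_det (A @ q # B @ [u]) =
    rows_det (p # A @ q # B) * rows_det (A @ r # B @ [u]) +
    rows_det (p # A @ B @ [u]) * rows_det (A @ q # r # B)"
proof -
  define \<omega> where "\<omega> x y = rows_det (x # y # A @ B)" for x y
  define \<alpha> :: 'a where "\<alpha> = (- 1) ^ length A"
  define \<beta> :: 'a where "\<beta> = (- 1) ^ length B"
  have sq: "\<alpha> * \<alpha> = 1" "\<beta> * \<beta> = 1"
    by (simp_all add: \<alpha>_def \<beta>_def flip: power_mult_distrib)
  have nz: "\<alpha> \<noteq> 0" "\<beta> \<noteq> 0" using sq by auto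
  have front: "rows_det (x # A @ y # B) = \<alpha> * \<omega> x y" for x y
    using rows_det_move [of "[x]" y A B] sq by (simp add: \<omega>_def \<alpha>_def flip: mult.assoc)
  have behind: "rows_det (A @ x # B @ [y]) = \<beta> * \<omega> x y" for x y
  proof -
    have "\<omega> x y = \<alpha> * \<beta> * rows_det (x # A @ B @ [y])"
      using rows_det_move [of "[x]" y "A @ B" "[]"] by (simp add: \<omega>_def \<alpha>_def \<beta>_def power_add)
    also have "rows_det (x # A @ B @ [y]) = \<alpha> * rows_det (A @ x # B @ [y])"
      using rows_det_move [of "[]" x A "B @ [y]"] by (simp add: \<alpha>_def)
    finally show ?thesis using sq by (simp add: algebra_simps)
  qed
  have ends: "rows_det (p # A @ B @ [u]) = \<alpha> * \<beta> * \<omega> p u"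
    using rows_det_move [of "[p]" u "A @ B" "[]"] sq
    by (simp add: \<omega>_def \<alpha>_def \<beta>_def power_add algebra_simps)
  have mid: "rows_det (A @ q # r # B) = \<omega> q r"
  proof -
    have "\<omega> q r = \<alpha> * rows_det (q # A @ r # B)"
      using front sq by (simp flip: mult.assoc)
    also have "\<dots> = rows_det (A @ q # r # B)"
      using rows_det_move [of "[]" q A "r # B"] sq by (simp add: \<alpha>_def flip: mult.assoc)
    finally show ?thesis by simp
  qed
  have anti: "\<omega> x y = - \<omega> y x" for x y
    unfolding \<omega>_def using rows_det_swap [of "[]" x y "A @ B"] by simp
  have "\<omega> p r * \<omega> q u = \<omega> p q * \<omega> r u + \<omega> p u * \<omega> q r"
  proof (cases "\<omega> p r = 0")
    case False
    then show ?thesis unfolding \<omega>_def by (rule rows_det_pluecker_front)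
  next
    case True
    with assms have "\<omega> q u \<noteq> 0" by (auto simp: front behind)
    \<comment> \<open>The same relation with the pairs \<open>(p, r)\<close> and
      \<open>(q, u)\<close> exchanged.\<close>
    then have "\<omega> q u * \<omega> p r = \<omega> q p * \<omega> u r + \<omega> q r * \<omega> p u"
      unfolding \<omega>_def by (rule rows_det_pluecker_front)
    then show ?thesis using anti [of q p] anti [of u r] by (simp add: algebra_simps)
  qed
  then show ?thesis
    by (simp add: front behind ends mid algebra_simps)
qed

subsection \<open>Minors formed by two blocks of consecutive vectors\<close>

definition block :: "(int \<Rightarrow> 'b) \<Rightarrow> int \<Rightarrow> nat \<Rightarrow> 'b list" where
  "block v a k = map (\<lambda>i. v (a + int i)) [0..<k]"

lemma length_block [simp]: "length (block v a k) = k"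
  by (simp add: block_def)

lemma block_0 [simp]: "block v a 0 = []"
  by (simp add: block_def)

lemma block_Suc: "block v a (Suc k) = v a # block v (a + 1) k"
  unfolding block_def by (rule nth_equalityI) (auto simp: nth_Cons algebra_simps simp del: upt_Suc split: nat.split)

lemma block_Suc_right: "block v a (Suc k) = block v a k @ [v (a + int k)]"
  by (simp add: block_def)

lemma block_append: "block v a j @ block v (a + int j) k = block v a (j + k)"
  by (induction k) (simp_all add: block_Suc_right add_ac flip: append_assoc)

lemma block_cong: "(\<And>i. a \<le> i \<Longrightarrow> i < a + int k \<Longrightarrow> v i = w i) \<Longrightarrow> block v a k = block w a k"
  by (simp add: block_def)

lemma triangular_system_solution:
  fixes c :: "nat \<Rightarrow> nat \<Rightarrow> 'a::field"
  assumes "\<And>i. i < m \<Longrightarrow> c i i \<noteq> 0" "\<And>i j. j < i \<Longrightarrow> i < m \<Longrightarrow> c i j = 0"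
  shows "\<exists>w. \<forall>i<m. (\<Sum>j<m. w j * c i j) = d i"
proof -
  \<comment> \<open>Back substitution: \<open>k\<close> counts the equations already solved, from
    the last upwards. The next unknown has coefficient zero in all of them.\<close>
  have "k \<le> m \<Longrightarrow> \<exists>w. \<forall>i<m. m - k \<le> i \<longrightarrow> (\<Sum>j<m. w j * c i j) = d i" for k
  proof (induction k)
    case (Suc k)
    then obtain w where w: "\<And>i. i < m \<Longrightarrow> m - k \<le> i \<Longrightarrow> (\<Sum>j<m. w j * c i j) = d i"
      by auto
    let ?l = "m - Suc k"
    have l: "?l < m" using Suc.prems by simp
    define w' where "w' = w(?l := (d ?l - (\<Sum>j\<in>{..<m} - {?l}. w j * c ?l j)) / c ?l ?l)"
    have "(\<Sum>j<m. w' j * c i j) = d i" if i: "i < m" "?l \<le> i" for i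
    proof (cases "i = ?l")
      case True
      have "(\<Sum>j<m. w' j * c ?l j) = w' ?l * c ?l ?l + (\<Sum>j\<in>{..<m} - {?l}. w' j * c ?l j)"
        using l by (intro sum.remove) auto
      also have "(\<Sum>j\<in>{..<m} - {?l}. w' j * c ?l j) = (\<Sum>j\<in>{..<m} - {?l}. w j * c ?l j)"
        by (intro sum.cong) (auto simp: w'_def)
      finally show ?thesis using True assms(1) [OF l] by (simp add: w'_def)
    next
      case False
      then have "c i ?l = 0" using i by (intro assms(2)) auto
      then have "(\<Sum>j<m. w' j * c i j) = (\<Sum>j<m. w j * c i j)"
        by (intro sum.cong) (auto simp: w'_def)
      then show ?thesis using w [of i] i False by auto
    qed
    then show ?case by blast
  qed auto
  from this [of m] show ?thesis by auto
qed

lemma quasi_periodic_extension: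
  fixes g :: "int \<Rightarrow> 'a::field"
  assumes "0 < N" "\<kappa> \<noteq> 0"
  obtains G where "\<And>i. 0 \<le> i \<Longrightarrow> i < N \<Longrightarrow> G i = g i" "\<And>i. G (i + N) = \<kappa> * G i"
proof
  show "\<kappa> powi (i div N) * g (i mod N) = g i" if "0 \<le> i" "i < N" for i
    using that by simp
  show "\<kappa> powi ((i + N) div N) * g ((i + N) mod N) = \<kappa> * (\<kappa> powi (i div N) * g (i mod N))" for i
    using assms by (simp add: power_int_add)
qed

lemma rows_det_standard_basis:
  "rows_det (block (\<lambda>i j. of_bool (int j = i)) 0 m) = (1 :: 'a::comm_ring_1)"
proof -
  have "mat m m (\<lambda>(i, j). (block (\<lambda>i j. of_bool (int j = i)) 0 m ! i) j) = (1\<^sub>m m :: 'a mat)"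
    by (rule eq_matI) (auto simp: block_def)
  then show ?thesis by (simp add: rows_det_def)
qed

text \<open>
  The minors with fixed \<open>a = 0\<close> are independent coordinates: starting from the standard
  basis, each new vector is found by solving a triangular linear system whose
  diagonal consists of earlier minors.
\<close>

lemma two_block_minors_prescribed:
  fixes D :: "nat \<Rightarrow> nat \<Rightarrow> 'a::field"
  assumes "\<And>x y. x \<le> m \<Longrightarrow> y \<le> n \<Longrightarrow> D x y \<noteq> 0"
    and "\<And>x. x \<le> m \<Longrightarrow> D x 0 = 1" and "\<And>y. y \<le> n \<Longrightarrow> D m y = 1"
  shows "\<exists>v. (\<forall>i<m. v (int i) = (\<lambda>j. of_bool (j = i))) \<and>
    (\<forall>x\<le>m. \<forall>y\<le>n. rows_det (block v 0 x @ block v (int x + int y) (m - x)) = D x y)"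
  using assms
proof (induction n)
  case 0
  let ?v = "\<lambda>i j. of_bool (int j = i) :: 'a"
  have "rows_det (block ?v 0 x @ block ?v (int x + int 0) (m - x)) = D x 0" if "x \<le> m" for x
    using that block_append [of ?v 0 x "m - x"] 0(2) by (simp add: rows_det_standard_basis)
  then show ?case by (intro exI [of _ ?v]) auto
next
  case (Suc n)
  then have "\<exists>v. (\<forall>i<m. v (int i) = (\<lambda>j. of_bool (j = i))) \<and>
    (\<forall>x\<le>m. \<forall>y\<le>n. rows_det (block v 0 x @ block v (int x + int y) (m - x)) = D x y)"
    by auto
  then obtain v where v: "\<And>i. i < m \<Longrightarrow> v (int i) = (\<lambda>j. of_bool (j = i))"
    and vD: "\<And>x y. x \<le> m \<Longrightarrow> y \<le> n \<Longrightarrow>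
      rows_det (block v 0 x @ block v (int x + int y) (m - x)) = D x y" by blast
  \<comment> \<open>In the minor at \<open>(x, Suc n)\<close> with \<open>x < m\<close>, the only
    new vector is the last row, of index \<open>m + n\<close>; \<open>rest x\<close> is the second
    block without it.\<close>
  define rest where "rest x = block v (int x + int n + 1) (m - Suc x)" for x
  have "\<forall>x. \<exists>c. \<forall>w. rows_det ((block v 0 x @ rest x) @ w # []) =
      (\<Sum>j < Suc (length (block v 0 x @ rest x) + length ([] :: (nat \<Rightarrow> 'a) list)). w j * c j)"
    using rows_det_linear_form by blast
  then obtain c where "\<And>x w. rows_det ((block v 0 x @ rest x) @ w # []) =
      (\<Sum>j < Suc (length (block v 0 x @ rest x) + length ([] :: (nat \<Rightarrow> 'a) list)). w j * c x j)"
    by metis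
  then have c: "rows_det (block v 0 x @ rest x @ [w]) = (\<Sum>j<m. w j * c x j)" if "x < m" for x w
    using that by (simp add: rest_def del: sum.lessThan_Suc)
  have coeff: "c x j = rows_det (block v 0 x @ rest x @ [v (int j)])" if "x < m" "j < m" for x j
    using that by (simp add: c v)
  \<comment> \<open>Here the last row is the basis vector \<open>v (int x)\<close>. Moved up to the
    first block, it extends that block and gives, up to sign, the earlier minor at
    \<open>(Suc x, n)\<close>.\<close>
  have diag: "c x x \<noteq> 0" if x: "x < m" for x
  proof -
    have "rows_det (block v 0 (Suc x) @ rest x) = D (Suc x) n"
      using vD [of "Suc x" n] x by (simp add: rest_def add_ac)
    then have "rows_det (block v 0 x @ v (int x) # rest x @ []) \<noteq> 0"
      using Suc.prems(1) [of "Suc x" n] x by (simp add: block_Suc_right)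
    then show ?thesis using x by (simp only: rows_det_move) (simp add: coeff)
  qed
  \<comment> \<open>The vector \<open>v (int j)\<close> already occurs in the first block.\<close>
  have lower: "c x j = 0" if "j < x" "x < m" for x j
  proof -
    have "block v 0 x = take j (block v 0 x) @ v (int j) # drop (Suc j) (block v 0 x)"
      using that id_take_nth_drop [of j "block v 0 x"] by (simp add: block_def)
    then have "block v 0 x @ rest x @ [v (int j)]
        = take j (block v 0 x) @ v (int j) # (drop (Suc j) (block v 0 x) @ rest x) @ v (int j) # []"
      by (metis append.assoc append_Cons)
    then show ?thesis using that by (simp only: coeff rows_det_repeated less_trans)
  qed
  obtain w where w: "\<And>x. x < m \<Longrightarrow> (\<Sum>j<m. w j * c x j) = D x (Suc n)"
    using triangular_system_solution [of m c "\<lambda>x. D x (Suc n)"] diag lower by blast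
  define v' where "v' = v(int m + int n := w)"
  \<comment> \<open>Earlier minors use only indices below \<open>m + n\<close>, so the new vector
    does not disturb them.\<close>
  have same: "block v' i k = block v i k" if "i + int k \<le> int m + int n" for i k
    using that by (intro block_cong) (auto simp: v'_def)
  have "rows_det (block v' 0 x @ block v' (int x + int y) (m - x)) = D x y"
    if xy: "x \<le> m" "y \<le> Suc n" for x y
  proof (cases "y = Suc n")
    case False
    then show ?thesis using xy vD [of x y] by (simp add: same)
  next
    case True
    show ?thesis
    proof (cases "x = m")
      case True
      then show ?thesis using xy vD [of m 0] Suc.prems(2) [of m] Suc.prems(3) [of y] by (simp add: same)
    next
      case False
      with xy have x: "x < m" by simp
      then have "block v' (int x + int y) (m - x)
          = block v' (int x + int y) (m - Suc x) @ [v' (int x + int y + int (m - Suc x))]"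
        using block_Suc_right [of v' "int x + int y" "m - Suc x"] by (simp only: Suc_diff_Suc)
      also have "\<dots> = rest x @ [w]"
        unfolding rest_def
      proof (intro arg_cong2 [of _ _ _ _ "(@)"])
        have "int x + int y = int x + int n + 1" using True by simp
        moreover have "int x + int y + int (m - Suc x) \<le> int m + int n" using x True by simp
        ultimately show "block v' (int x + int y) (m - Suc x) = block v (int x + int n + 1) (m - Suc x)"
          using same by metis
        have "int x + int y + int (m - Suc x) = int m + int n" using x True by simp
        then show "[v' (int x + int y + int (m - Suc x))] = [w]" by (simp only: v'_def fun_upd_same)
      qed
      finally have "rows_det (block v' 0 x @ block v' (int x + int y) (m - x))
          = rows_det (block v 0 x @ rest x @ [w])"
        using x by (simp add: same)
      also have "\<dots> = D x y" using x True by (simp add: c w)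
      finally show ?thesis .
    qed
  qed
  moreover have "v' (int i) = (\<lambda>j. of_bool (j = i))" if "i < m" for i
    using that v by (simp add: v'_def)
  ultimately show ?case by blast
qed

section \<open>Minors of a quasi-periodic sequence of vectors\<close>

locale quasi_periodic_rows =
  fixes m n :: nat and v :: "int \<Rightarrow> nat \<Rightarrow> 'a::field"
  assumes m: "0 < m" and n: "0 < n"
    and quasi_periodic: "v (i + (int m + int n)) = (\<lambda>j. (- 1) ^ (m - 1) * v i j)"
begin

definition minor :: "int \<Rightarrow> nat \<Rightarrow> nat \<Rightarrow> 'a" where
  "minor a x y = rows_det (block v a x @ block v (a + int x + int y) (m - x))"

lemma block_shift:
  "block v (a + (int m + int n)) k = map (\<lambda>u j. (- 1) ^ (m - 1) * u j) (block v a k)"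
proof -
  have "v (a + (int m + int n) + i) = (\<lambda>j. (- 1) ^ (m - 1) * v (a + i) j)" for i
    using quasi_periodic [of "a + i"] by (simp add: add_ac)
  then show ?thesis by (simp add: block_def)
qed

text \<open>
  The sign \<open>(-1)\<^bsup>m-1\<^esup>\<close> in the quasi-periodicity compensates the sign of the
  cyclic permutation of the rows.
\<close>

lemma minor_rotate:
  assumes "x \<le> m" "y \<le> n"
  shows "minor a x y = minor (a + int x + int y - (int m + int n)) (m - x) (n - y)"
proof -
  let ?b = "a + int x + int y - (int m + int n)"
  have "block v (a + int x + int y) (m - x) = map (\<lambda>u j. (- 1) ^ (m - 1) * u j) (block v ?b (m - x))"
    using block_shift [of ?b "m - x"] by simp
  then have "minor a x y = ((- 1) ^ (m - 1)) ^ (m - x) * (- 1) ^ (x * (m - x))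
      * rows_det (block v ?b (m - x) @ block v a x)"
    by (simp only: minor_def rows_det_append_map_scale [of _ "(- 1) ^ (m - 1)"]
        rows_det_rotate [of "block v a x"] length_block mult.assoc)
  \<comment> \<open>The total exponent is \<open>(m - x) * (m - 1 + x)\<close>, whose factors have
    opposite parity.\<close>
  also have "((- 1) ^ (m - 1)) ^ (m - x) * (- 1) ^ (x * (m - x)) = (1 :: 'a)"
    using assms m by (auto simp: minus_one_power_iff simp flip: power_mult)
  finally show ?thesis
    using assms by (simp add: minor_def of_nat_diff algebra_simps)
qed

lemma minor_bottom: "x \<le> m \<Longrightarrow> minor a x 0 = rows_det (block v a m)"
  by (simp add: minor_def block_append)

lemma minor_right: "minor a m y = rows_det (block v a m)"
  by (simp add: minor_def)

lemma minor_left: "minor a 0 y = rows_det (block v (a + int y) m)"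
  by (simp add: minor_def)

lemma minor_top: "x \<le> m \<Longrightarrow> minor a x n = rows_det (block v (a + int x - int m) m)"
  using minor_rotate [of x n a] minor_bottom [of "m - x"] by simp

text \<open>Each of the \<open>m\<close> rows contributes \<open>(-1) ^ (m - 1)\<close>, and
  \<open>m * (m - 1)\<close> is even.\<close>

lemma rows_det_block_shift:
  "rows_det (block v (a + (int m + int n)) m) = rows_det (block v a m)"
proof -
  have "rows_det (block v (a + (int m + int n)) m) = ((- 1) ^ (m - 1)) ^ m * rows_det (block v a m)"
    using rows_det_append_map_scale [of "[]" "(- 1) ^ (m - 1)" "block v a m"]
    by (simp only: block_shift append_Nil length_block)
  also have "((- 1) ^ (m - 1)) ^ m = (1 :: 'a)"
    using m by (auto simp: minus_one_power_iff simp flip: power_mult)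
  finally show ?thesis by simp
qed

text \<open>The blocks at \<open>a\<close> and \<open>a + 1\<close> overlap in \<open>A\<close> and
  \<open>B\<close>; \<open>p\<close> and \<open>q\<close> bound the first overlap, \<open>r\<close>
  and \<open>u\<close> the second. All six minors are made of these pieces, in the pattern of
  \<open>rows_det_pluecker\<close>.\<close>

lemma minor_octahedron:
  assumes "0 < x" "x < m" "0 < y"
    and nz: "minor a x y \<noteq> 0 \<or> minor (a + 1) x y \<noteq> 0"
  shows "minor a x y * minor (a + 1) x y =
    minor a (x + 1) y * minor (a + 1) (x - 1) y + minor a x (y + 1) * minor (a + 1) x (y - 1)"
proof -
  obtain x' where x: "x = Suc x'" using assms(1) by (cases x) auto
  obtain y' where y: "y = Suc y'" using assms(3) by (cases y) auto
  define k where "k = m - Suc x"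
  have k: "m - x = Suc k" "m - x' = Suc (Suc k)" "m - Suc x = k"
    using assms(2) by (auto simp: k_def x)
  define A where "A = block v (a + 1) x'"
  define B where "B = block v (a + int x + int y + 1) k"
  define p q r u where "p = v a" and "q = v (a + int x)" and "r = v (a + int x + int y)"
    and "u = v (a + int x + int y + int k + 1)"
  have A: "block v a x = p # A" "block v (a + 1) x = A @ [q]" "block v a (Suc x) = p # A @ [q]"
    "block v (a + 1) x' = A"
  proof -
    show "block v a x = p # A" "block v (a + 1) x' = A"
      by (simp_all only: A_def p_def x block_Suc)
    have "a + 1 + int x' = a + int x" by (simp add: x)
    then show *: "block v (a + 1) x = A @ [q]"
      by (simp only: A_def q_def x block_Suc_right)
    show "block v a (Suc x) = p # A @ [q]"
      by (simp only: block_Suc [of _ _ x] * p_def)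
  qed
  have B: "block v (a + int x + int y) (Suc k) = r # B"
    "block v (a + int x + int y + 1) (Suc k) = B @ [u]"
    "block v (a + int x + int y) (Suc (Suc k)) = r # B @ [u]"
    "block v (a + int x + int y + 1) k = B"
  proof -
    show "block v (a + int x + int y) (Suc k) = r # B" "block v (a + int x + int y + 1) k = B"
      by (simp_all only: B_def r_def block_Suc)
    show *: "block v (a + int x + int y + 1) (Suc k) = B @ [u]"
      by (simp only: B_def u_def block_Suc_right add_ac)
    show "block v (a + int x + int y) (Suc (Suc k)) = r # B @ [u]"
      by (simp only: block_Suc [of _ _ "Suc k"] * r_def)
  qed
  have "minor a x y = rows_det (p # A @ r # B)"
    unfolding minor_def k A B by simp
  moreover have "minor (a + 1) x y = rows_det (A @ q # B @ [u])"
    using A B by (simp add: minor_def k add_ac)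
  moreover have "minor a (x + 1) y = rows_det (p # A @ q # B)"
    using A B by (simp add: minor_def k add_ac)
  moreover have "minor (a + 1) (x - 1) y = rows_det (A @ r # B @ [u])"
    using A B by (simp add: minor_def k x add_ac)
  moreover have "minor a x (y + 1) = rows_det (p # A @ B @ [u])"
    using A B by (simp add: minor_def k add_ac)
  moreover have "minor (a + 1) x (y - 1) = rows_det (A @ q # r # B)"
    using A B by (simp add: minor_def k y add_ac)
  ultimately show ?thesis
    using nz rows_det_pluecker [of p A r B q u] by simp
qed

end

subsection \<open>Solutions over a field\<close>

text \<open>
  Slices are indexed by \<open>a = (t - x - y) / 2\<close>: \<open>h x y a\<close> stands for \<open>f (x, y, x + y + 2a)\<close>, and the
  centre of the recurrence is \<open>(x, y, x + y + 2a + 1)\<close>.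
\<close>

definition octahedron_rhs ::
    "nat \<Rightarrow> nat \<Rightarrow> (nat \<Rightarrow> nat \<Rightarrow> int \<Rightarrow> 'a::{plus, times}) \<Rightarrow> nat \<Rightarrow> nat \<Rightarrow> int \<Rightarrow> 'a" where
  "octahedron_rhs m n h x y a =
    (if 0 < x \<and> x < m \<and> 0 < y \<and> y < n then
       h (x + 1) y a * h (x - 1) y (a + 1) + h x (y + 1) a * h x (y - 1) (a + 1)
     else if 0 < x \<and> x < m then h (x + 1) y a * h (x - 1) y (a + 1)
     else if 0 < y \<and> y < n then h x (y + 1) a * h x (y - 1) (a + 1)
     else (if x = 0 then h 1 y a else h (m - 1) y (a + 1)) *
          (if y = 0 then h x 1 a else h x (n - 1) (a + 1)))"

text \<open>
  Plane waves such as \<open>\<gamma>\<close> multiply both products of the recurrence by the same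
  factor. They are needed because the consecutive minors of \<open>v\<close> depend on \<open>a\<close>
  alone along the bottom side, so they only produce one of the two families of
  waves which travel along the boundary of the rectangle.
\<close>

locale octahedron_solution = quasi_periodic_rows +
  fixes \<gamma> :: "int \<Rightarrow> 'a" and \<kappa> :: 'a
  assumes \<gamma>: "\<gamma> (i + (int m + int n)) = \<kappa> * \<gamma> i"
    and \<gamma>_0: "\<gamma> 0 \<noteq> 0"
begin

text \<open>One wave depends on the start \<open>a\<close> of the first block, the other on the
  start \<open>a + x + y\<close> of the second. Dividing by \<open>\<gamma> 0\<close> makes the
  first wave 1 on the slice \<open>a = 0\<close>.\<close>

definition sol :: "nat \<Rightarrow> nat \<Rightarrow> int \<Rightarrow> 'a" where
  "sol x y a = \<gamma> a / \<gamma> 0 * \<gamma> (a + int x + int y) * minor a x y"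

lemma sol_periodic:
  assumes "x \<le> m" "y \<le> n"
  shows "sol x y a = \<kappa> * sol (m - x) (n - y) (a + int x + int y - int m - int n)"
proof -
  let ?b = "a + int x + int y - (int m + int n)"
  \<comment> \<open>Rotation interchanges the two waves; the one shifted by a full period yields
    \<open>\<kappa>\<close>.\<close>
  have wave: "\<gamma> (a + int x + int y) = \<kappa> * \<gamma> ?b" using \<gamma> [of ?b] by simp
  have idx: "?b + int (m - x) + int (n - y) = a" using assms by (simp add: of_nat_diff)
  have regroup: "p / z * (k * q) * r = k * (q / z * p * r)" for p q r k z :: 'a
    by simp
  have "sol x y a = \<kappa> * sol (m - x) (n - y) ?b"
    unfolding sol_def minor_rotate [OF assms, of a] wave idx by (rule regroup)
  then show ?thesis by (simp add: algebra_simps)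
qed

text \<open>In the interior, the relation between minors is multiplied by a common product of waves.
  On the sides and corners every minor is a determinant of \<open>m\<close> consecutive vectors, and
  both sides have the same factors up to shifts by a full period.\<close>

lemma sol_recurrence:
  assumes "x \<le> m" "y \<le> n" and nz: "sol x y a \<noteq> 0 \<or> sol x y (a + 1) \<noteq> 0"
  shows "sol x y a * sol x y (a + 1) = octahedron_rhs m n sol x y a"
proof -
  have shift: "rows_det (block v (a + int n) m) = rows_det (block v (a - int m) m)"
    using rows_det_block_shift [of "a - int m"] by (simp add: algebra_simps)
  have wrap: "\<gamma> (a + int m + int n) = \<kappa> * \<gamma> a" "\<gamma> (a + 1 + int m + int n) = \<kappa> * \<gamma> (a + 1)"
    using \<gamma> [of a] \<gamma> [of "a + 1"] by (simp_all add: add_ac)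
  have "x = 0 \<or> x = m \<or> 0 < x \<and> x < m" "y = 0 \<or> y = n \<or> 0 < y \<and> y < n"
    using assms(1,2) by auto
  then consider (int) "0 < x" "x < m" "0 < y" "y < n"
    | (bot) "0 < x" "x < m" "y = 0" | (top) "0 < x" "x < m" "y = n"
    | (left) "x = 0" "0 < y" "y < n" | (right) "x = m" "0 < y" "y < n"
    | (c00) "x = 0" "y = 0" | (c0n) "x = 0" "y = n" | (cm0) "x = m" "y = 0" | (cmn) "x = m" "y = n"
    by blast
  then show ?thesis
  proof cases
    case int
    have nz': "minor a x y \<noteq> 0 \<or> minor (a + 1) x y \<noteq> 0" using nz by (auto simp: sol_def)
    have idx: "a + 1 + int (x - 1) + int y = a + int x + int y"
      "a + 1 + int x + int (y - 1) = a + int x + int y"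
      "a + int (x + 1) + int y = a + 1 + int x + int y"
      "a + int x + int (y + 1) = a + 1 + int x + int y"
      using int by (simp_all add: of_nat_diff)
    define g where "g = \<gamma> a / \<gamma> 0 * \<gamma> (a + int x + int y) *
        (\<gamma> (a + 1) / \<gamma> 0 * \<gamma> (a + 1 + int x + int y))"
    have "sol x y a * sol x y (a + 1) = g * (minor a x y * minor (a + 1) x y)"
      unfolding sol_def g_def by (simp only: mult_ac)
    also have "\<dots> = g * (minor a (x + 1) y * minor (a + 1) (x - 1) y) +
        g * (minor a x (y + 1) * minor (a + 1) x (y - 1))"
      unfolding minor_octahedron [OF int(1-3) nz'] by (rule distrib_left)
    also have "g * (minor a (x + 1) y * minor (a + 1) (x - 1) y) = sol (x + 1) y a * sol (x - 1) y (a + 1)"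
      unfolding sol_def g_def idx by (simp only: mult_ac)
    also have "g * (minor a x (y + 1) * minor (a + 1) x (y - 1)) = sol x (y + 1) a * sol x (y - 1) (a + 1)"
      unfolding sol_def g_def idx by (simp only: mult_ac)
    also have "sol (x + 1) y a * sol (x - 1) y (a + 1) + sol x (y + 1) a * sol x (y - 1) (a + 1)
        = octahedron_rhs m n sol x y a"
      using int by (simp add: octahedron_rhs_def)
    finally show ?thesis .
  next
    case bot
    then show ?thesis
      by (simp add: octahedron_rhs_def sol_def minor_bottom of_nat_diff algebra_simps)
  next
    case top
    then show ?thesis using n
      by (simp add: octahedron_rhs_def sol_def minor_top of_nat_diff algebra_simps)
  next
    case left
    then show ?thesis using m
      by (simp add: octahedron_rhs_def sol_def minor_left of_nat_diff algebra_simps)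
  next
    case right
    then show ?thesis
      by (simp add: octahedron_rhs_def sol_def minor_right of_nat_diff algebra_simps)
  next
    case c00
    then show ?thesis using m n
      by (simp add: octahedron_rhs_def sol_def minor_left minor_bottom algebra_simps)
  next
    case c0n
    then show ?thesis using m n minor_top [of 0 "a + 1"]
      by (simp add: octahedron_rhs_def sol_def minor_left minor_top [of "Suc 0"] of_nat_diff shift algebra_simps)
  next
    case cm0
    then show ?thesis using m n
      by (simp add: octahedron_rhs_def sol_def minor_right minor_bottom of_nat_diff algebra_simps)
  next
    case cmn
    then show ?thesis using m n wrap
      by (simp add: octahedron_rhs_def sol_def minor_right minor_top of_nat_diff algebra_simps)
  qed
qed

end

lemma octahedron_solution_exists:
  fixes F :: "nat \<Rightarrow> nat \<Rightarrow> 'a::field"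
  assumes m: "0 < m" and n: "0 < n" and F: "\<And>x y. x \<le> m \<Longrightarrow> y \<le> n \<Longrightarrow> F x y \<noteq> 0"
  obtains h where "\<And>x y. x \<le> m \<Longrightarrow> y \<le> n \<Longrightarrow> h x y 0 = F x y"
    and "\<And>x y a. x \<le> m \<Longrightarrow> y \<le> n \<Longrightarrow>
      h x y a = F m n / F 0 0 * h (m - x) (n - y) (a + int x + int y - int m - int n)"
    and "\<And>x y a. x \<le> m \<Longrightarrow> y \<le> n \<Longrightarrow> h x y a \<noteq> 0 \<or> h x y (a + 1) \<noteq> 0 \<Longrightarrow>
      h x y a * h x y (a + 1) = octahedron_rhs m n h x y a"
proof -
  let ?N = "int m + int n"
  \<comment> \<open>The minors to be prescribed equal 1 on the bottom and right sides, so
    \<open>\<gamma> (x + y)\<close> must carry \<open>F\<close> there. Along these sides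
    \<open>x + y\<close> runs from \<open>0\<close> to \<open>m + n\<close>, and comparing the two
    ends forces \<open>\<kappa>\<close>.\<close>
  define \<kappa> where "\<kappa> = F m n / F 0 0"
  define g where "g q = (if q \<le> m then F q 0 else F m (q - m))" for q
  have g: "g (x + y) \<noteq> 0" if "x \<le> m" "y \<le> n" for x y
    using that F by (simp add: g_def)
  have \<kappa>: "\<kappa> \<noteq> 0" using F by (simp add: \<kappa>_def)
  obtain \<gamma> where \<gamma>: "\<And>i. 0 \<le> i \<Longrightarrow> i < ?N \<Longrightarrow> \<gamma> i = g (nat i)" "\<And>i. \<gamma> (i + ?N) = \<kappa> * \<gamma> i"
    using quasi_periodic_extension [of ?N \<kappa> "\<lambda>i. g (nat i)"] m \<kappa> by auto
  have \<gamma>_0: "\<gamma> 0 = F 0 0" using \<gamma>(1) [of 0] m by (simp add: g_def)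
  have \<gamma>_g: "\<gamma> (int x + int y) = g (x + y)" if "x \<le> m" "y \<le> n" for x y
  proof (cases "x + y = m + n")
    case True
    then have "\<gamma> (int x + int y) = \<kappa> * \<gamma> 0"
      using \<gamma>(2) [of 0] by (simp flip: of_nat_add)
    then show ?thesis
      using True n F [of 0 0] by (simp add: \<gamma>_0 \<kappa>_def g_def)
  next
    case False
    with that have "\<gamma> (int x + int y) = g (nat (int x + int y))" by (intro \<gamma>(1)) auto
    then show ?thesis by (simp flip: of_nat_add)
  qed
  have "\<exists>v. (\<forall>i<m. v (int i) = (\<lambda>j. of_bool (j = i))) \<and>
    (\<forall>x\<le>m. \<forall>y\<le>n. rows_det (block v 0 x @ block v (int x + int y) (m - x)) = F x y / g (x + y))"
  proof (rule two_block_minors_prescribed)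
    show "F x y / g (x + y) \<noteq> 0" if "x \<le> m" "y \<le> n" for x y
      using that F g by simp
    show "F x 0 / g (x + 0) = 1" if "x \<le> m" for x
      using that F by (simp add: g_def)
    show "F m y / g (m + y) = 1" if "y \<le> n" for y
      using that F by (auto simp: g_def)
  qed
  then obtain w where w: "\<And>x y. x \<le> m \<Longrightarrow> y \<le> n \<Longrightarrow>
      rows_det (block w 0 x @ block w (int x + int y) (m - x)) = F x y / g (x + y)"
    by blast
  have "\<exists>G. (\<forall>i. 0 \<le> i \<longrightarrow> i < ?N \<longrightarrow> G i = w i j) \<and> (\<forall>i. G (i + ?N) = (- 1) ^ (m - 1) * G i)" for j
  proof -
    obtain G where "\<And>i. 0 \<le> i \<Longrightarrow> i < ?N \<Longrightarrow> G i = w i j" "\<And>i. G (i + ?N) = (- 1) ^ (m - 1) * G i"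
      using quasi_periodic_extension [of ?N "(- 1) ^ (m - 1)" "\<lambda>i. w i j"] m by auto
    then show ?thesis by blast
  qed
  then obtain G where G: "\<And>j i. 0 \<le> i \<Longrightarrow> i < ?N \<Longrightarrow> G j i = w i j"
    "\<And>j i. G j (i + ?N) = (- 1) ^ (m - 1) * G j i" by metis
  define v where "v i = (\<lambda>j. G j i)" for i
  interpret octahedron_solution m n v \<gamma> \<kappa>
    by unfold_locales (use m n F \<gamma>(2) \<gamma>_0 G(2) in \<open>simp_all add: v_def\<close>)
  have "sol x y 0 = F x y" if "x \<le> m" "y \<le> n" for x y
  proof -
    \<comment> \<open>Minors on the slice \<open>a = 0\<close> use indices of a single period, where
      the extension agrees with \<open>w\<close>.\<close>
    have "block v i k = block w i k" if "0 \<le> i" "i + int k \<le> ?N" for i k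
      using that by (intro block_cong) (auto simp: v_def G(1))
    then have "minor 0 x y = F x y / g (x + y)"
      using that by (simp add: minor_def w)
    then show ?thesis using that g \<gamma>_0 F [of 0 0] by (simp add: sol_def \<gamma>_g)
  qed
  moreover note sol_periodic sol_recurrence
  ultimately show thesis using that [of sol] unfolding \<kappa>_def by blast
qed

subsection \<open>Transfer to semifields\<close>

text \<open>The neighbours on slice \<open>a\<close> have larger \<open>x + y\<close> and those on
  slice \<open>a + 1\<close> smaller \<open>x + y\<close>. This split supports an induction within a
  slice in either time direction.\<close>

lemma specializes_octahedron_rhs:
  assumes "x \<le> m" "y \<le> n" "0 < m" "0 < n"
    and "\<And>x' y'. x' \<le> m \<Longrightarrow> y' \<le> n \<Longrightarrow> x + y < x' + y' \<Longrightarrow> specializes s (H x' y' a) (h x' y' a)"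
    and "\<And>x' y'. x' \<le> m \<Longrightarrow> y' \<le> n \<Longrightarrow> x' + y' < x + y \<Longrightarrow>
      specializes s (H x' y' (a + 1)) (h x' y' (a + 1))"
  shows "specializes s (octahedron_rhs m n H x y a) (octahedron_rhs m n h x y a)"
proof -
  have right: "x < m \<Longrightarrow> specializes s (H (x + 1) y a) (h (x + 1) y a)"
    and above: "y < n \<Longrightarrow> specializes s (H x (y + 1) a) (h x (y + 1) a)"
    and left: "0 < x \<Longrightarrow> specializes s (H (x - 1) y (a + 1)) (h (x - 1) y (a + 1))"
    and below: "0 < y \<Longrightarrow> specializes s (H x (y - 1) (a + 1)) (h x (y - 1) (a + 1))"
    using assms(1,2) by (auto intro!: assms(5,6))
  have "x = 0 \<or> x = m \<or> 0 < x \<and> x < m" "y = 0 \<or> y = n \<or> 0 < y \<and> y < n"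
    using assms(1,2) by auto
  then show ?thesis
    using right above left below assms(3,4)
    by (elim disjE; simp add: octahedron_rhs_def specializes_add specializes_mult)
qed

text \<open>Both solutions arise from slice 0 by the same operations. A value of \<open>H\<close>
  that specializes is nonzero, which supplies the condition in the recurrence and permits the
  division.\<close>

lemma specializes_octahedron_solution:
  assumes mn: "0 < m" "0 < n"
    and H: "\<And>x y a. x \<le> m \<Longrightarrow> y \<le> n \<Longrightarrow> H x y a \<noteq> 0 \<or> H x y (a + 1) \<noteq> 0 \<Longrightarrow>
      H x y a * H x y (a + 1) = octahedron_rhs m n H x y a"
    and h: "\<And>x y a. x \<le> m \<Longrightarrow> y \<le> n \<Longrightarrow> h x y a * h x y (a + 1) = octahedron_rhs m n h x y a"
    and init: "\<And>x y. x \<le> m \<Longrightarrow> y \<le> n \<Longrightarrow> specializes s (H x y 0) (h x y 0)"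
    and "x \<le> m" "y \<le> n"
  shows "specializes s (H x y a) (h x y a)"
proof -
  have up: "specializes s (H x y (a + 1)) (h x y (a + 1))"
    if a: "\<And>x y. x \<le> m \<Longrightarrow> y \<le> n \<Longrightarrow> specializes s (H x y a) (h x y a)"
      and "x \<le> m" "y \<le> n" for x y a
    using that(2,3)
  \<comment> \<open>Solving for slice \<open>a + 1\<close> needs its values at smaller
    \<open>x + y\<close>.\<close>
  proof (induction "x + y" arbitrary: x y rule: less_induct)
    case less
    have 1: "specializes s (H x y a) (h x y a)" using a less.prems by blast
    have eqs: "H x y (a + 1) = octahedron_rhs m n H x y a / H x y a"
      "h x y (a + 1) = octahedron_rhs m n h x y a / h x y a"
      using H [of x y a] h [of x y a] less.prems specializes_nonzero [OF 1]
      by (simp_all add: nonzero_eq_divide_eq semifield_eq_divide mult.commute)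
    have "specializes s (octahedron_rhs m n H x y a) (octahedron_rhs m n h x y a)"
      using less a mn by (intro specializes_octahedron_rhs) auto
    from specializes_divide [OF this 1] show ?case by (simp only: eqs)
  qed
  have down: "specializes s (H x y a) (h x y a)"
    if a: "\<And>x y. x \<le> m \<Longrightarrow> y \<le> n \<Longrightarrow> specializes s (H x y (a + 1)) (h x y (a + 1))"
      and "x \<le> m" "y \<le> n" for x y a
    using that(2,3)
  \<comment> \<open>Solving backwards needs slice \<open>a\<close> at larger \<open>x + y\<close>,
    hence the induction on the distance to the corner \<open>(m, n)\<close>.\<close>
  proof (induction "(m - x) + (n - y)" arbitrary: x y rule: less_induct)
    case less
    have 1: "specializes s (H x y (a + 1)) (h x y (a + 1))" using a less.prems by blast
    have eqs: "H x y a = octahedron_rhs m n H x y a / H x y (a + 1)"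
      "h x y a = octahedron_rhs m n h x y a / h x y (a + 1)"
      using H [of x y a] h [of x y a] less.prems specializes_nonzero [OF 1]
      by (simp_all add: nonzero_eq_divide_eq semifield_eq_divide)
    have "specializes s (octahedron_rhs m n H x y a) (octahedron_rhs m n h x y a)"
      using less a mn by (intro specializes_octahedron_rhs) auto
    from specializes_divide [OF this 1] show ?case
      by (subst eqs(1), subst eqs(2))
  qed
  have "\<forall>x\<le>m. \<forall>y\<le>n. specializes s (H x y a) (h x y a)"
  proof (induction a rule: int_induct [of _ 0])
    case base
    then show ?case using init by blast
  next
    case (step1 i)
    then show ?case using up [of i] by blast
  next
    case (step2 i)
    then show ?case using down [of "i - 1"] by simp
  qed
  then show ?thesis using assms by blast
qed

text \<open>The centre has \<open>t = x + y + 2 * a + 1\<close>, so its neighbours at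
  \<open>x + 1\<close> and \<open>y + 1\<close> lie on slice \<open>a\<close>, those at
  \<open>x - 1\<close> and \<open>y - 1\<close> on slice \<open>a + 1\<close>.\<close>

lemma bounded_octahedron_recurrence_slices:
  assumes rec: "bounded_octahedron_recurrence (int m) (int n) f" and "0 < m" "0 < n"
    and h: "h = (\<lambda>x y a. f (int x, int y, int x + int y + 2 * a))"
    and "x \<le> m" "y \<le> n"
  shows "h x y a * h x y (a + 1) = octahedron_rhs m n h x y a"
proof -
  let ?X = "int x" and ?Y = "int y"
  let ?t = "int x + int y + 2 * a + 1"
  have odd: "odd (?X + ?Y + ?t)"
    by simp
  have ext: "0 \<le> ?X" "?X \<le> int m" "0 \<le> ?Y" "?Y \<le> int n" using assms by auto
  note rec' = rec [unfolded bounded_octahedron_recurrence_def, rule_format,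
      OF conjI [OF ext(1) conjI [OF ext(2) conjI [OF ext(3) conjI [OF ext(4) odd]]]]]
  have lhs: "h x y a * h x y (a + 1) = z" if "f (?X, ?Y, ?t + 1) = z / f (?X, ?Y, ?t - 1)" for z
  proof -
    have "f (?X, ?Y, ?t + 1) * f (?X, ?Y, ?t - 1) = z"
      using that by (simp only: semifield_eq_divide)
    then show ?thesis by (simp add: h mult.commute algebra_simps)
  qed
  have nbr: "h (x + 1) y a = f (?X + 1, ?Y, ?t)" "h x (y + 1) a = f (?X, ?Y + 1, ?t)"
    by (simp_all add: h algebra_simps)
  have nbr': "0 < x \<Longrightarrow> h (x - 1) y (a + 1) = f (?X - 1, ?Y, ?t)"
    "0 < y \<Longrightarrow> h x (y - 1) (a + 1) = f (?X, ?Y - 1, ?t)"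
    by (simp_all add: h of_nat_diff algebra_simps)
  have "x = 0 \<or> x = m \<or> 0 < x \<and> x < m" "y = 0 \<or> y = n \<or> 0 < y \<and> y < n"
    using assms by auto
  then consider (int) "0 < x" "x < m" "0 < y" "y < n"
    | (horizontal) "0 < x" "x < m" "y = 0 \<or> y = n"
    | (vertical) "x = 0 \<or> x = m" "0 < y" "y < n"
    | (c00) "x = 0" "y = 0" | (c0n) "x = 0" "y = n" | (cm0) "x = m" "y = 0" | (cmn) "x = m" "y = n"
    by blast
  then show ?thesis
  proof cases
    case int
    then show ?thesis using rec' nbr nbr' by (intro lhs) (simp add: octahedron_rhs_def)
  next
    case horizontal
    then show ?thesis using rec' nbr nbr' by (intro lhs) (auto simp: octahedron_rhs_def)
  next
    case vertical
    then show ?thesis using rec' nbr nbr' assms(2,3) by (intro lhs) (auto simp: octahedron_rhs_def)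
  next
    case c00
    then show ?thesis using rec' nbr nbr' assms(2,3) by (intro lhs) (auto simp: octahedron_rhs_def)
  next
    case c0n
    then show ?thesis using rec' nbr nbr' assms(2,3) by (intro lhs) (auto simp: octahedron_rhs_def)
  next
    case cm0
    then show ?thesis using rec' nbr nbr' assms(2,3) by (intro lhs) (auto simp: octahedron_rhs_def)
  next
    case cmn
    then show ?thesis using rec' nbr nbr' assms(2,3) by (intro lhs) (auto simp: octahedron_rhs_def)
  qed
qed

theorem theorem1:
  fixes m n :: int and f :: "int \<times> int \<times> int \<Rightarrow> 'a::semifield"
  assumes "0 < m" and "0 < n"
    and "bounded_octahedron_recurrence m n f"
  shows "\<exists>c. \<forall>(x, y, t) \<in> octahedron_lattice m n.
           f (x, y, t) = c * f (m - x, n - y, t - m - n)"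
proof -
  define M N where "M = nat m" and "N = nat n"
  have mn: "m = int M" "n = int N" and MN: "0 < M" "0 < N"
    using assms by (simp_all add: M_def N_def)
  define h where "h = (\<lambda>x y a. f (int x, int y, int x + int y + 2 * a))"
  have h: "h x y a * h x y (a + 1) = octahedron_rhs M N h x y a" if "x \<le> M" "y \<le> N" for x y a
    using bounded_octahedron_recurrence_slices assms(3) MN h_def that unfolding mn by blast
  \<comment> \<open>Each point of the slice \<open>a = 0\<close> gets its own variable, numbered by
    \<open>prod_encode\<close>; \<open>s\<close> substitutes the given initial values.\<close>
  define s where "s k = (case prod_decode k of (x, y) \<Rightarrow> h x y 0)" for k
  define F where "F x y = indet (prod_encode (x, y))" for x y
  have F: "specializes s (F x y) (h x y 0)" for x y
    using specializes_indet [of s "prod_encode (x, y)"] by (simp add: F_def s_def)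
  obtain H where H0: "\<And>x y. x \<le> M \<Longrightarrow> y \<le> N \<Longrightarrow> H x y 0 = F x y"
    and periodic: "\<And>x y a. x \<le> M \<Longrightarrow> y \<le> N \<Longrightarrow>
      H x y a = F M N / F 0 0 * H (M - x) (N - y) (a + int x + int y - int M - int N)"
    and H: "\<And>x y a. x \<le> M \<Longrightarrow> y \<le> N \<Longrightarrow> H x y a \<noteq> 0 \<or> H x y (a + 1) \<noteq> 0 \<Longrightarrow>
      H x y a * H x y (a + 1) = octahedron_rhs M N H x y a"
    using octahedron_solution_exists [OF MN, of F] F specializes_nonzero by metis
  have spec: "specializes s (H x y a) (h x y a)" if "x \<le> M" "y \<le> N" for x y a
    using that
  proof (rule specializes_octahedron_solution [OF MN, rotated 3])
    show "specializes s (H x y 0) (h x y 0)" if "x \<le> M" "y \<le> N" for x y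
      using F H0 that by simp
  qed (fact H h)+
  \<comment> \<open>Both sides specialize the same rational function \<open>H x y a\<close>, the
    right one through the periodicity of \<open>H\<close>. The constant is
    \<open>f (m, n, m + n) / f (0, 0, 0)\<close>.\<close>
  have period: "h x y a = h M N 0 / h 0 0 0 * h (M - x) (N - y) (a + int x + int y - int M - int N)"
    if "x \<le> M" "y \<le> N" for x y a
  proof (rule specializes_unique)
    show "specializes s (H x y a) (h x y a)" using spec that .
    show "specializes s (H x y a)
        (h M N 0 / h 0 0 0 * h (M - x) (N - y) (a + int x + int y - int M - int N))"
      unfolding periodic [OF that, of a]
      by (intro specializes_mult specializes_divide F spec) auto
  qed
  have "f (x, y, t) = h M N 0 / h 0 0 0 * f (m - x, n - y, t - m - n)"
    if "(x, y, t) \<in> octahedron_lattice m n" for x y t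
  proof -
    define X Y where "X = nat x" and "Y = nat y"
    have xy: "x = int X" "y = int Y" "X \<le> M" "Y \<le> N" and "even (x + y + t)"
      using that by (auto simp: octahedron_lattice_def X_def Y_def M_def N_def)
    then have "even (t - x - y)" by presburger
    then obtain a where "t - x - y = 2 * a" ..
    then have t: "t = int X + int Y + 2 * a" by (simp add: xy)
    show ?thesis
      using period [OF xy(3,4), of a] xy(3,4)
      by (simp add: h_def xy(1,2) t mn of_nat_diff algebra_simps)
  qed
  then show ?thesis by blast
qed

end
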